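(* Let $0<\lambda<2$, and let $(a_n)_{n=0}^{\infty}\subset S^1$ be a greedy $\lambda$-energy sequence with $a_0=1$. For $N\ge1$ let $U_N(x)=\sum_{k=0}^{N-1}|x-a_k|^\lambda$. Then the sequence $(U_N(a_N)-N I_\lambda(\sigma_1))_{N=1}^{\infty}$ is bounded and divergent (i.e., not convergent). For each $N\geq 1$, $$0<U_N(a_N)-N I_\lambda(\sigma_1)<I_\lambda(\sigma_1).$$ These inequalities are sharp, since we have $$\liminf_{N\to\infty}\,(U_N(a_N)-N I_\lambda(\sigma_1))=0,\qquad \limsup_{N\to\infty}\,(U_N(a_N)-N I_\lambda(\sigma_1))=I_\lambda(\sigma_1).$$
   Context: $S^1$ is the unit circle, viewed as the set of complex numbers of modulus $1$. For $\lambda>0$, a greedy $\lambda$-energy sequence on $S^1$ is a sequence $(a_n)_{n=0}^{\infty}\subset S^1$ such that $\sum_{k=0}^{n-1}|a_n-a_k|^{\lambda}=\max_{x\in S^1}\sum_{k=0}^{n-1}|x-a_k|^{\lambda}$ for all $n\geq 1$. $\sigma_1$ is the normalized arc-length (uniform probability) measure on $S^1$, and $I_\lambda(\sigma_1)=\iint_{S^1\times S^1}|x-y|^\lambda\,d\sigma_1(x)\,d\sigma_1(y)=\frac{2^{\lambda}\,\Gamma((1+\lambda)/2)}{\sqrt{\pi}\,\Gamma(1+\lambda/2)}$. *)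

theory Defs
  imports "HOL-Analysis.Analysis"
begin

abbreviation unit_circle :: "complex set"
  where "unit_circle \<equiv> sphere 0 1"

text \<open>Normalized arc-length measure on the unit circle, as the image of the uniform
  probability measure on \<open>[0, 2\<pi>]\<close> under the arc-length parametrization \<open>t \<mapsto> e\<^sup>i\<^sup>t\<close>.\<close>

definition circle_measure :: "complex measure"
  where "circle_measure =
    distr (uniform_measure lborel {0..2 * pi}) (restrict_space borel unit_circle) cis"

definition riesz_energy :: "real \<Rightarrow> complex measure \<Rightarrow> real"
  where "riesz_energy lam \<mu> = (LINT (x, y)|(\<mu> \<Otimes>\<^sub>M \<mu>). cmod (x - y) powr lam)"

definition riesz_potential :: "real \<Rightarrow> (nat \<Rightarrow> complex) \<Rightarrow> nat \<Rightarrow> complex \<Rightarrow> real"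
  where "riesz_potential lam a N x = (\<Sum>k<N. cmod (x - a k) powr lam)"

definition greedy_energy_sequence :: "real \<Rightarrow> (nat \<Rightarrow> complex) \<Rightarrow> bool"
  where "greedy_energy_sequence lam a \<longleftrightarrow>
    (\<forall>n. a n \<in> unit_circle) \<and>
    (\<forall>n\<ge>1. \<forall>x\<in>unit_circle. riesz_potential lam a n x \<le> riesz_potential lam a n (a n))"

end

theory Submission
  imports Defs
begin

text \<open>
Write \<open>I\<close> for the energy and call a solution of \<open>z\<^bsup>2^n\<^esup> = c\<close>, \<open>|c| = 1\<close>, a dyadic root of
  \<open>c\<close> of level \<open>n\<close>. The proof describes the greedy points through dyadic roots and then
  telescopes.

  \<^bold>\<open>Potential of dyadic roots.\<close> For \<open>0 < s < 1\<close> the power \<open>X\<^sup>s\<close> is a positive constant times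
  the integral of \<open>t\<^bsup>s-1\<^esup> X / (X + t)\<close> over \<open>t > 0\<close>. Put \<open>s = \<lambda>/2\<close> and \<open>X = |x - z|\<^sup>2\<close>; with
  \<open>r \<in> (0,1)\<close> defined by \<open>t r = (1 - r)\<^sup>2\<close> the integrand becomes an affine, decreasing function of
  the Poisson kernel with parameter \<open>r\<close> at the angle between \<open>x\<close> and \<open>z\<close>. Poisson kernels
  add up in closed form over equally spaced points: summing over the dyadic roots of \<open>c\<close> gives
  \<open>2\<^sup>n\<close> times the kernel with parameter \<open>r\<^bsup>2^n\<^esup>\<close> at the angle between \<open>x\<^bsup>2^n\<^esup>\<close> and \<open>c\<close>
  (lemma \<open>sum_poisson_dyadic_roots\<close>). Hence the potential of the dyadic roots is a strictly decreasing
  function of \<open>Re (x\<^bsup>2^n\<^esup> cnj c)\<close>. It is least at the roots and is largest exactly at the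
  midpoints, where \<open>x\<^bsup>2^n\<^esup> = - c\<close>. Let \<open>E\<^sub>n\<close> and \<open>H\<^sub>n\<close> be these extreme values. Dominated
  convergence under the integral gives \<open>H\<^sub>n - E\<^sub>n \<longlongrightarrow> 0\<close>.

  \<^bold>\<open>Comparison with the energy.\<close> The potential of the dyadic roots has average \<open>2\<^sup>n I\<close> over
  the circle, so \<open>E\<^sub>n \<le> 2\<^sup>n I \<le> H\<^sub>n\<close>. The roots of \<open>1\<close> of level \<open>n + 1\<close> are the roots of level
  \<open>n\<close> of \<open>1\<close> together with those of \<open>- 1\<close>, so \<open>E\<^bsub>n+1\<^esub> = E\<^sub>n + H\<^sub>n\<close>. With the
  deficit \<open>e\<^sub>n = 2\<^sup>n I - E\<^sub>n\<close> this reads \<open>H\<^sub>n - 2\<^sup>n I = e\<^sub>n - e\<^bsub>n+1\<^esub>\<close>. The deficits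
  decrease strictly from \<open>e\<^sub>0 = I\<close> to the limit \<open>0\<close>.

  \<^bold>\<open>Greedy points.\<close> Suppose that the first \<open>2\<^sup>n\<close> greedy points are the dyadic roots of some
  \<open>c\<close>. The next \<open>2\<^sup>n\<close> points then form a greedy sequence of their own inside the midpoints: a
  maximizer of their potential can be found among the midpoints, where the potential of the first
  block is also maximal, so both summands are maximized at once (lemma \<open>greedy_prefix_tail\<close>).
  Consequently, for \<open>m < 2\<^sup>n\<close>, the excess \<open>U\<^sub>N(a\<^sub>N) - N I\<close> at \<open>N = 2\<^sup>n + m\<close> equals
  \<open>e\<^sub>n - e\<^bsub>n+1\<^esub>\<close> plus the excess at \<open>m\<close> of the shifted greedy sequence. It is therefore the sum
  of \<open>e\<^sub>j - e\<^bsub>j+1\<^esub>\<close> over the binary digits \<open>1\<close> of \<open>N\<close>. For \<open>1 \<le> N < 2\<^sup>n\<close> it lies strictly above \<open>0\<close>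
  and at most at \<open>e\<^sub>0 - e\<^sub>n < I\<close>. The choice \<open>N = 2\<^sup>n\<close> makes it tend to \<open>0\<close>, and
  \<open>N = 2\<^sup>n - 1\<close> makes it tend to \<open>I\<close>.
\<close>

section \<open>Poisson kernels over dyadic roots\<close>

text \<open>The Poisson kernel of the unit disc at radius \<open>r\<close>, as a function of the cosine \<open>u\<close> of the angle.\<close>
definition poisson :: "real \<Rightarrow> real \<Rightarrow> real"
  where "poisson r u = (1 - r\<^sup>2) / (1 + r\<^sup>2 - 2 * r * u)"

lemma poisson_denominator_pos:
  assumes "0 \<le> r" "r < 1" "u \<le> 1"
  shows "0 < 1 + r\<^sup>2 - 2 * r * (u::real)"
proof -
  have "2 * r * u \<le> 2 * r * 1" using assms by (intro mult_left_mono) auto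
  moreover have "0 < (1 - r)\<^sup>2" using assms by auto
  ultimately show ?thesis by (simp add: power2_eq_square algebra_simps)
qed

lemma poisson_strict_mono:
  assumes "0 < r" "r < 1" "u < v" "v \<le> 1"
  shows "poisson r u < poisson r v"
proof -
  have "0 < 1 + r\<^sup>2 - 2 * r * v" using assms by (intro poisson_denominator_pos) auto
  moreover have "2 * r * u < 2 * r * v" using assms by simp
  moreover have "0 < 1 - r\<^sup>2" using assms by (simp add: power_less_one_iff)
  ultimately show ?thesis unfolding poisson_def by (intro divide_strict_left_mono mult_pos_pos) auto
qed

text \<open>The values at \<open>u\<close> and \<open>- u\<close> belong to antipodal points, and \<open>2 u\<^sup>2 - 1\<close> is the cosine of the
  doubled angle. The product of the two denominators is the denominator for \<open>r\<^sup>2\<close> at the doubled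
  angle, which is why the sum of two antipodal kernels is again a kernel.\<close>
lemma poisson_doubling:
  assumes "0 \<le> r" "r < 1" "\<bar>u\<bar> \<le> 1"
  shows "poisson r u + poisson r (- u) = 2 * poisson (r\<^sup>2) (2 * u\<^sup>2 - 1)"
proof -
  have 1: "0 < 1 + r\<^sup>2 - 2 * r * u" "0 < 1 + r\<^sup>2 - 2 * r * (- u)"
    using assms by (intro poisson_denominator_pos; simp)+
  have "(1 + r\<^sup>2 - 2 * r * u) * (1 + r\<^sup>2 - 2 * r * (- u)) = 1 + (r\<^sup>2)\<^sup>2 - 2 * r\<^sup>2 * (2 * u\<^sup>2 - 1)"
    by (simp add: power2_eq_square algebra_simps)
  moreover have "poisson r u + poisson r (- u)
    = (1 - r\<^sup>2) * (2 * (1 + r\<^sup>2)) / ((1 + r\<^sup>2 - 2 * r * u) * (1 + r\<^sup>2 - 2 * r * (- u)))"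
    unfolding poisson_def using 1 by (simp add: add_frac_eq del: mult_minus_right) (simp add: algebra_simps)
  moreover have "(1 - r\<^sup>2) * (2 * (1 + r\<^sup>2)) = 2 * (1 - (r\<^sup>2)\<^sup>2)"
    by (simp add: power2_eq_square algebra_simps)
  ultimately show ?thesis unfolding poisson_def by simp
qed

abbreviation dyadic_roots :: "nat \<Rightarrow> complex \<Rightarrow> complex set"
  where "dyadic_roots n c \<equiv> {z. z ^ (2 ^ n) = c}"

lemma finite_dyadic_roots: "finite (dyadic_roots n c)"
  by (rule finite_nth_roots) simp

lemma norm_dyadic_root:
  assumes "cmod c = 1" "z \<in> dyadic_roots n c" shows "cmod z = 1"
proof -
  have "cmod z ^ (2 ^ n) = 1" using assms by (simp flip: norm_power)
  then show ?thesis using power_eq_1_iff[of "cmod z" "2 ^ n"] by auto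
qed

text \<open>Squaring maps the roots of level \<open>n + 1\<close> two-to-one onto those of level \<open>n\<close>. This turns a sum
  over one level into a sum of antipodal pairs over the level below.\<close>
lemma sum_dyadic_roots_Suc:
  fixes g :: "complex \<Rightarrow> real"
  assumes "c \<noteq> 0"
  shows "(\<Sum>z\<in>dyadic_roots (Suc n) c. g z) = (\<Sum>w\<in>dyadic_roots n c. g (csqrt w) + g (- csqrt w))"
proof -
  have e: "(z\<^sup>2) ^ (2 ^ n) = z ^ (2 ^ Suc n)" for z :: complex
    by (simp flip: power_mult)
  have "(\<Sum>z\<in>dyadic_roots (Suc n) c. g z)
    = (\<Sum>w\<in>dyadic_roots n c. \<Sum>z\<in>{z \<in> dyadic_roots (Suc n) c. z\<^sup>2 = w}. g z)"
    by (rule sum.group[symmetric]) (auto simp: finite_dyadic_roots e simp del: power_Suc)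
  also have "\<dots> = (\<Sum>w\<in>dyadic_roots n c. g (csqrt w) + g (- csqrt w))"
  proof (rule sum.cong[OF refl])
    fix w assume w: "w \<in> dyadic_roots n c"
    then have "w \<noteq> 0" using assms by auto
    have "{z \<in> dyadic_roots (Suc n) c. z\<^sup>2 = w} = {csqrt w, - csqrt w}"
    proof -
      have "z\<^sup>2 = w \<longleftrightarrow> z = csqrt w \<or> z = - csqrt w" for z
        by (metis power2_csqrt power2_eq_iff)
      moreover have "z ^ 2 ^ Suc n = c" if "z\<^sup>2 = w" for z
        using w that e[of z] by simp
      ultimately show ?thesis by (auto simp del: power_Suc)
    qed
    moreover have "csqrt w \<noteq> - csqrt w" using \<open>w \<noteq> 0\<close> by simp
    ultimately show "(\<Sum>z\<in>{z \<in> dyadic_roots (Suc n) c. z\<^sup>2 = w}. g z) = g (csqrt w) + g (- csqrt w)"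
      by simp
  qed
  finally show ?thesis .
qed

lemma abs_Re_le_1: "cmod z = 1 \<Longrightarrow> \<bar>Re z\<bar> \<le> 1"
  using abs_Re_le_cmod[of z] by simp

lemma Re_square_unit:
  assumes "cmod z = 1" shows "Re (z\<^sup>2) = 2 * (Re z)\<^sup>2 - 1"
  using assms cmod_power2[of z] by (simp add: power2_eq_square)

text \<open>Grouping the roots into antipodal pairs and doubling the angle lowers the level by one and replaces
  \<open>r\<close> and \<open>x\<close> by their squares; after \<open>n\<close> rounds only the single point \<open>c\<close> is left.\<close>
lemma sum_poisson_dyadic_roots:
  assumes "0 \<le> r" "r < 1" "cmod c = 1" "cmod x = 1"
  shows "(\<Sum>z\<in>dyadic_roots n c. poisson r (Re (x * cnj z)))
    = 2 ^ n * poisson (r ^ (2 ^ n)) (Re (x ^ (2 ^ n) * cnj c))"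
  using assms(1,2,4)
proof (induction n arbitrary: r x)
  case 0
  then show ?case by (simp add: singleton_conv)
next
  case (Suc n)
  have c: "c \<noteq> 0" using assms(3) by auto
  have "(\<Sum>z\<in>dyadic_roots (Suc n) c. poisson r (Re (x * cnj z)))
    = (\<Sum>w\<in>dyadic_roots n c. 2 * poisson (r\<^sup>2) (Re (x\<^sup>2 * cnj w)))"
    unfolding sum_dyadic_roots_Suc[OF c]
  proof (rule sum.cong[OF refl])
    fix w assume "w \<in> dyadic_roots n c"
    then have "cmod (csqrt w) = 1"
      using norm_dyadic_root[OF assms(3), of w n] by simp
    then have 1: "cmod (x * cnj (csqrt w)) = 1" using Suc.prems by (simp add: norm_mult)
    have "(x * cnj (csqrt w))\<^sup>2 = x\<^sup>2 * cnj w"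
      by (simp add: power_mult_distrib flip: complex_cnj_power)
    then show "poisson r (Re (x * cnj (csqrt w))) + poisson r (Re (x * cnj (- csqrt w)))
      = 2 * poisson (r\<^sup>2) (Re (x\<^sup>2 * cnj w))"
      using poisson_doubling[OF Suc.prems(1,2) abs_Re_le_1[OF 1]] Re_square_unit[OF 1] by simp
  qed
  also have "\<dots> = 2 * (2 ^ n * poisson ((r\<^sup>2) ^ (2 ^ n)) (Re ((x\<^sup>2) ^ (2 ^ n) * cnj c)))"
    unfolding sum_distrib_left[symmetric] using Suc.prems
    by (subst Suc.IH) (auto simp: power_less_one_iff norm_power)
  finally show ?case by (simp flip: power_mult)
qed

section \<open>Integral representation of the power function\<close>

text \<open>The root in \<open>(0,1)\<close> of \<open>t r = (1 - r)\<^sup>2\<close>. It is the radius for which \<open>2 - 2 u + t\<close> is, up to the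
  factor \<open>r\<close>, the denominator of the Poisson kernel.\<close>
definition radius :: "real \<Rightarrow> real"
  where "radius t = 1 + t / 2 - sqrt (t + t\<^sup>2 / 4)"

lemma radius:
  assumes "0 < t"
  shows "0 < radius t" "radius t < 1" "t * radius t = (1 - radius t)\<^sup>2"
proof -
  let ?d = "sqrt (t + t\<^sup>2 / 4)"
  have d2: "?d\<^sup>2 = t + t\<^sup>2 / 4" using assms by simp
  have "t / 2 < ?d"
    by (rule real_less_rsqrt) (use assms in \<open>simp add: power2_eq_square\<close>)
  then show "radius t < 1" by (simp add: radius_def)
  have "?d < 1 + t / 2"
    by (rule real_less_lsqrt) (use assms in \<open>auto simp: power2_eq_square algebra_simps\<close>)
  then show "0 < radius t" by (simp add: radius_def)
  show "t * radius t = (1 - radius t)\<^sup>2"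
    using d2 unfolding radius_def by (simp add: power2_eq_square algebra_simps)
qed

text \<open>This decay at infinity supplies the integrable majorant for dominated convergence.\<close>
lemma radius_le:
  assumes "0 < t" shows "radius t \<le> 1 / (1 + t)"
proof -
  have "radius t * (1 + t) = 1 - radius t * (1 - radius t)"
    using radius(3)[OF assms] by (simp add: power2_eq_square algebra_simps)
  also have "\<dots> \<le> 1" using radius[OF assms] by simp
  finally show ?thesis using assms by (simp add: field_simps)
qed

text \<open>If \<open>u\<close> is the cosine of the angle between two points of the circle, then \<open>2 - 2 u\<close> is their squared
  distance \<open>X\<close>. The kernel \<open>X / (X + t)\<close> of the integral representation is thus affine in a Poisson
  kernel.\<close>
lemma cauchy_kernel_eq_poisson:
  assumes "0 < t" "u \<le> 1"
  shows "(2 - 2 * u) / (2 - 2 * u + t)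
    = 1 - (1 - radius t) / (1 + radius t) * poisson (radius t) u"
proof -
  define r where "r = radius t"
  have r: "0 < r" "r < 1" "t * r = (1 - r)\<^sup>2" using radius[OF assms(1)] by (auto simp: r_def)
  have p: "0 < 1 + r\<^sup>2 - 2 * r * u" using r assms by (intro poisson_denominator_pos) auto
  have q: "r * (2 - 2 * u + t) = 1 + r\<^sup>2 - 2 * r * u"
    using r(3) by (simp add: power2_eq_square algebra_simps)
  have X: "0 < 2 - 2 * u + t" using assms by auto
  have "(2 - 2 * u) / (2 - 2 * u + t) = 1 - t / (2 - 2 * u + t)"
    using X by (simp add: field_simps)
  also have "t / (2 - 2 * u + t) = (t * r) / (1 + r\<^sup>2 - 2 * r * u)"
    unfolding q[symmetric] r(3)[symmetric] using r(1) by simp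
  also have "\<dots> = (1 - r) / (1 + r) * poisson r u"
  proof -
    have "1 - r\<^sup>2 = (1 - r) * (1 + r)" by (simp add: power2_eq_square algebra_simps)
    then show ?thesis
      unfolding poisson_def using r by (simp add: power2_eq_square)
  qed
  finally show ?thesis by (simp add: r_def)
qed

lemma dist_sq_unit:
  assumes "cmod x = 1" "cmod z = 1"
  shows "(cmod (x - z))\<^sup>2 = 2 - 2 * Re (x * cnj z)"
  using assms cmod_power2[of x] cmod_power2[of z] cmod_power2[of "x-z"]
  by (simp add: power2_eq_square algebra_simps)

definition weight :: "real \<Rightarrow> real \<Rightarrow> real"
  where "weight s t = indicator {0<..} t * t powr (s - 1)"

lemma weight_simps: "0 < t \<Longrightarrow> weight s t = t powr (s - 1)" "t \<le> 0 \<Longrightarrow> weight s t = 0"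
  by (auto simp: weight_def)

lemma weight_nonneg: "0 \<le> weight s t" by (simp add: weight_def)

text \<open>The two hypotheses on \<open>s\<close> answer to the two ends of the half-line: \<open>t\<^bsup>s-1\<^esup>\<close> is integrable
  at \<open>0\<close> because \<open>s > 0\<close>, and \<open>t\<^bsup>s-2\<^esup>\<close> is integrable at infinity because \<open>s < 1\<close>.\<close>
lemma integrable_weight_over:
  assumes "0 < s" "s < 1"
  shows "integrable lborel (\<lambda>t. weight s t / (1 + t))"
proof -
  let ?g = "\<lambda>t. indicator {0..1} t *\<^sub>R t powr (s - 1) + indicator {1..} t *\<^sub>R t powr (s - 2)"
  have 1: "set_integrable lborel {0..1} (\<lambda>t. t powr (s - 1))"
  proof -
    have "(\<lambda>t. t powr (s - 1)) absolutely_integrable_on {0..1::real}"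
      using integrable_on_powr_from_0[of "s-1" 1] assms
      by (intro nonnegative_absolutely_integrable_1) auto
    then show ?thesis
      unfolding set_integrable_def by (subst (asm) integrable_completion) auto
  qed
  have 2: "set_integrable lborel {1..} (\<lambda>t. t powr (s - 2))"
  proof -
    have "(\<lambda>t. t powr (s - 2)) absolutely_integrable_on {1::real..}"
      using has_integral_powr_to_inf[of "s-2" 1] assms
      by (intro nonnegative_absolutely_integrable_1) auto
    then show ?thesis
      unfolding set_integrable_def by (subst (asm) integrable_completion) auto
  qed
  have "integrable lborel ?g"
    using 1 2 unfolding set_integrable_def by (rule Bochner_Integration.integrable_add)
  then show ?thesis
  proof (rule Bochner_Integration.integrable_bound)
    show "(\<lambda>t. weight s t / (1 + t)) \<in> borel_measurable lborel"
      unfolding weight_def by measurable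
    show "AE t in lborel. norm (weight s t / (1 + t)) \<le> norm (?g t)"
    proof (rule AE_I2)
      fix t :: real
      consider "t \<le> 0" | "0 < t" "t \<le> 1" | "1 < t" by linarith
      then show "norm (weight s t / (1 + t)) \<le> norm (?g t)"
      proof cases
        case 1 then show ?thesis by (simp add: weight_simps)
      next
        case 2
        then have "t powr (s - 1) / (1 + t) \<le> t powr (s - 1) / 1"
          by (intro divide_left_mono) auto
        moreover have "t powr (s - 1) \<le> ?g t" using 2 by simp
        ultimately have "t powr (s - 1) / (1 + t) \<le> ?g t" by linarith
        then show ?thesis using 2 by (simp add: weight_simps)
      next
        case 3
        then have "t powr (s - 1) / (1 + t) \<le> t powr (s - 1) / t"
          by (intro divide_left_mono) auto
        also have "\<dots> = t powr (s - 2)"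
          using 3 powr_mult_base[of t "s-2"] by (simp add: field_simps)
        also have "\<dots> = ?g t" using 3 by (simp add: indicator_def)
        finally show ?thesis using 3 by (simp add: weight_simps)
      qed
    qed
  qed
qed

text \<open>This is the Beta integral with value \<open>\<pi> / sin (\<pi> s)\<close>.\<close>
definition power_constant :: "real \<Rightarrow> real"
  where "power_constant s = (LINT t|lborel. weight s t / (1 + t))"

lemma integral_pos_halfline:
  fixes f :: "real \<Rightarrow> real"
  assumes "integrable lborel f" "\<And>t. 0 < t \<Longrightarrow> 0 < f t" "\<And>t. t \<le> 0 \<Longrightarrow> f t = 0"
  shows "0 < (LINT t|lborel. f t)"
proof -
  have nn: "0 \<le> f t" for t using assms(2,3)[of t] by (cases "0 < t") auto
  have "(LINT t|lborel. f t) \<noteq> 0"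
  proof
    assume "(LINT t|lborel. f t) = 0"
    then have "AE t in lborel. f t = 0"
      using integral_nonneg_eq_0_iff_AE[OF assms(1)] nn by simp
    then have "AE t::real in lborel. \<not> (t \<in> {0<..<1})"
      by (rule eventually_mono) (use assms(2) in force)
    then have "emeasure lborel {0<..<1::real} = 0"
      by (subst (asm) AE_iff_measurable[of "{0<..<1}"]) auto
    then show False by (simp del: greaterThanLessThan_iff add: emeasure_lborel_Ioo)
  qed
  moreover have "0 \<le> (LINT t|lborel. f t)" using nn by (intro integral_nonneg_AE) auto
  ultimately show ?thesis by simp
qed

lemma power_constant_pos:
  assumes "0 < s" "s < 1" shows "0 < power_constant s"
  unfolding power_constant_def
  by (rule integral_pos_halfline[OF integrable_weight_over[OF assms]]) (auto simp: weight_simps)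

text \<open>By homogeneity: the substitution \<open>t = X v\<close> reduces the integral to the one that defines the
  constant.\<close>
lemma power_integral_representation:
  assumes "0 < s" "s < 1" "0 \<le> X"
  shows "has_bochner_integral lborel (\<lambda>t. weight s t * (X / (X + t))) (power_constant s * X powr s)"
proof (cases "X = 0")
  case True then show ?thesis by (simp add: has_bochner_integral_zero)
next
  case False
  then have X: "0 < X" using assms by simp
  have "has_bochner_integral lborel (\<lambda>t. weight s t / (1 + t)) (power_constant s)"
    unfolding power_constant_def
    by (rule has_bochner_integral_integrable[OF integrable_weight_over[OF assms(1,2)]])
  then have "has_bochner_integral lborel (\<lambda>t. X powr (s - 1) * (weight s (0 + inverse X * t) / (1 + (0 + inverse X * t))))
    (X powr (s - 1) * (power_constant s /\<^sub>R \<bar>inverse X\<bar>))"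
    using X by (intro has_bochner_integral_mult_right)
      (subst (asm) lborel_has_bochner_integral_real_affine_iff[of "inverse X" _ _ 0], auto)
  moreover have "X powr (s - 1) * (power_constant s /\<^sub>R \<bar>inverse X\<bar>) = power_constant s * X powr s"
    using X powr_mult_base[of X "s-1"] by (simp add: field_simps)
  moreover have "X powr (s - 1) * (weight s (0 + inverse X * t) / (1 + (0 + inverse X * t)))
    = weight s t * (X / (X + t))" for t
  proof (cases "0 < t")
    case True
    then have "X powr (s - 1) * (inverse X * t) powr (s - 1) = t powr (s - 1)"
      using X powr_mult[of X "inverse X * t" "s - 1"] by (simp flip: mult.assoc)
    then show ?thesis using X True by (simp add: weight_simps field_simps)
  next
    case False
    then have "inverse X * t \<le> 0" using X by (simp add: mult_le_0_iff)
    then show ?thesis using False by (simp add: weight_simps)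
  qed
  ultimately show ?thesis by (simp only:)
qed


section \<open>The potential of the dyadic roots of a unit number\<close>

definition root_potential :: "real \<Rightarrow> nat \<Rightarrow> complex \<Rightarrow> complex \<Rightarrow> real"
  where "root_potential lam n c x = (\<Sum>z\<in>dyadic_roots n c. cmod (x - z) powr lam)"

text \<open>The density that the kernels \<open>X / (X + t)\<close> of all dyadic roots have together. It sees the position
  only through \<open>u\<close>, the cosine of the angle between \<open>x\<^bsup>2^n\<^esup>\<close> and \<open>c\<close>.\<close>
definition profile :: "nat \<Rightarrow> real \<Rightarrow> real \<Rightarrow> real"
  where "profile n u t = 2 ^ n * (1 - (1 - radius t) / (1 + radius t) * poisson (radius t ^ (2 ^ n)) u)"

lemma root_potential_representation:
  assumes "0 < lam" "lam < 2" "cmod c = 1" "cmod x = 1"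
  shows "has_bochner_integral lborel (\<lambda>t. weight (lam / 2) t * profile n (Re (x ^ (2 ^ n) * cnj c)) t)
    (power_constant (lam / 2) * root_potential lam n c x)"
proof -
  let ?X = "\<lambda>z. (cmod (x - z))\<^sup>2"
  have "has_bochner_integral lborel (\<lambda>t. \<Sum>z\<in>dyadic_roots n c. weight (lam / 2) t * (?X z / (?X z + t)))
    (\<Sum>z\<in>dyadic_roots n c. power_constant (lam / 2) * ?X z powr (lam / 2))"
    using assms by (intro has_bochner_integral_sum power_integral_representation) auto
  moreover have "(\<Sum>z\<in>dyadic_roots n c. power_constant (lam / 2) * ?X z powr (lam / 2))
    = power_constant (lam / 2) * root_potential lam n c x"
  proof -
    have "?X z powr (lam / 2) = cmod (x - z) powr lam" for z
      by (cases "x = z") (simp_all add: powr_powr flip: powr_numeral)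
    then show ?thesis by (simp add: root_potential_def sum_distrib_left)
  qed
  moreover have "(\<Sum>z\<in>dyadic_roots n c. weight (lam / 2) t * (?X z / (?X z + t)))
    = weight (lam / 2) t * profile n (Re (x ^ (2 ^ n) * cnj c)) t" for t
  proof (cases "0 < t")
    case False then show ?thesis by (simp add: weight_simps)
  next
    case True
    let ?q = "(1 - radius t) / (1 + radius t)"
    note r = radius[OF True]
    have "(\<Sum>z\<in>dyadic_roots n c. ?X z / (?X z + t))
      = (\<Sum>z\<in>dyadic_roots n c. 1 - ?q * poisson (radius t) (Re (x * cnj z)))"
    proof (rule sum.cong[OF refl])
      fix z assume "z \<in> dyadic_roots n c"
      then have z: "cmod z = 1" by (rule norm_dyadic_root[OF assms(3)])
      then have "cmod (x * cnj z) = 1" using assms by (simp add: norm_mult)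
      then have "Re (x * cnj z) \<le> 1" using abs_Re_le_1 by fastforce
      then show "?X z / (?X z + t) = 1 - ?q * poisson (radius t) (Re (x * cnj z))"
        unfolding dist_sq_unit[OF assms(4) z] by (rule cauchy_kernel_eq_poisson[OF True])
    qed
    also have "\<dots> = 2 ^ n - ?q * (\<Sum>z\<in>dyadic_roots n c. poisson (radius t) (Re (x * cnj z)))"
    proof -
      have "c \<noteq> 0" using assms(3) by auto
      then have "card (dyadic_roots n c) = 2 ^ n" by (intro card_nth_roots) auto
      then show ?thesis by (simp add: sum_subtractf sum_distrib_left)
    qed
    also have "\<dots> = profile n (Re (x ^ (2 ^ n) * cnj c)) t"
      using r assms
      by (subst sum_poisson_dyadic_roots) (auto simp: profile_def algebra_simps)
    finally show ?thesis by (simp only: sum_distrib_left[symmetric])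
  qed
  ultimately show ?thesis by (simp only:)
qed

lemma profile_strict_antimono:
  assumes "0 < t" "u < v" "v \<le> 1"
  shows "profile n v t < profile n u t"
proof -
  note r = radius[OF assms(1)]
  have "poisson (radius t ^ (2 ^ n)) u < poisson (radius t ^ (2 ^ n)) v"
    using r assms by (intro poisson_strict_mono) (auto simp: power_less_one_iff)
  moreover have "0 < (1 - radius t) / (1 + radius t)" using r by simp
  ultimately have "(1 - radius t) / (1 + radius t) * poisson (radius t ^ (2 ^ n)) u
    < (1 - radius t) / (1 + radius t) * poisson (radius t ^ (2 ^ n)) v"
    by (rule mult_strict_left_mono)
  then show ?thesis unfolding profile_def by (intro mult_strict_left_mono) auto
qed

text \<open>Comparing two integrals is enough, because the densities are ordered pointwise.\<close>
lemma root_potential_less: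
  assumes "0 < lam" "lam < 2" "cmod c = 1" "cmod x = 1" "cmod d = 1" "cmod y = 1"
    and "Re (x ^ (2 ^ n) * cnj c) < Re (y ^ (2 ^ n) * cnj d)"
  shows "root_potential lam n d y < root_potential lam n c x"
proof -
  let ?u = "Re (x ^ (2 ^ n) * cnj c)" and ?v = "Re (y ^ (2 ^ n) * cnj d)"
  let ?f = "\<lambda>u t. weight (lam / 2) t * profile n u t"
  have "cmod (y ^ (2 ^ n) * cnj d) = 1" using assms by (simp add: norm_mult norm_power)
  then have v: "?v \<le> 1" using abs_Re_le_1 by fastforce
  have b: "has_bochner_integral lborel (\<lambda>t. ?f ?u t - ?f ?v t)
    (power_constant (lam / 2) * root_potential lam n c x - power_constant (lam / 2) * root_potential lam n d y)"
    using assms by (intro has_bochner_integral_diff root_potential_representation) auto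
  have "0 < (LINT t|lborel. ?f ?u t - ?f ?v t)"
  proof (rule integral_pos_halfline)
    show "integrable lborel (\<lambda>t. ?f ?u t - ?f ?v t)" using b by (blast intro: integrable.intros)
  next
    fix t :: real assume t: "0 < t"
    then have "?f ?v t < ?f ?u t"
      using profile_strict_antimono[OF t assms(7) v, of n] by (simp add: weight_simps)
    then show "0 < ?f ?u t - ?f ?v t" by simp
  qed (simp add: weight_simps)
  then have "0 < power_constant (lam / 2) * (root_potential lam n c x - root_potential lam n d y)"
    using has_bochner_integral_integral_eq[OF b] by (simp add: right_diff_distrib)
  then show ?thesis
    using power_constant_pos[of "lam / 2"] assms by (simp add: zero_less_mult_iff)
qed

text \<open>A special case is invariance under rotation of the roots, so that the extreme values depend only on
  the level.\<close>
lemma root_potential_eq: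
  assumes "0 < lam" "lam < 2" "cmod c = 1" "cmod x = 1" "cmod d = 1" "cmod y = 1"
    and "Re (x ^ (2 ^ n) * cnj c) = Re (y ^ (2 ^ n) * cnj d)"
  shows "root_potential lam n c x = root_potential lam n d y"
  using has_bochner_integral_eq[OF root_potential_representation[OF assms(1-4), of n]
      root_potential_representation[OF assms(1,2,5,6), of n, folded assms(7)]]
    power_constant_pos[of "lam / 2"] assms by simp

text \<open>The extreme values of the potential. They are evaluated at \<open>x = 1\<close>, which is a root for \<open>c = 1\<close> and
  a midpoint for \<open>c = - 1\<close>.\<close>
definition min_potential :: "real \<Rightarrow> nat \<Rightarrow> real"
  where "min_potential lam n = root_potential lam n 1 1"

definition max_potential :: "real \<Rightarrow> nat \<Rightarrow> real"
  where "max_potential lam n = root_potential lam n (- 1) 1"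

lemma unit_eq_minus_1:
  assumes "cmod w = 1" "Re w = - 1" shows "w = - 1"
  using assms cmod_power2[of w] by (simp add: complex_eq_iff)

lemma root_potential_ge_min:
  assumes "0 < lam" "lam < 2" "cmod c = 1" "cmod x = 1"
  shows "min_potential lam n \<le> root_potential lam n c x"
proof (cases "Re (x ^ (2 ^ n) * cnj c) = 1")
  case True then show ?thesis
    unfolding min_potential_def using assms by (intro eq_refl root_potential_eq) auto
next
  case False
  have "cmod (x ^ (2 ^ n) * cnj c) = 1" using assms by (simp add: norm_mult norm_power)
  then have "Re (x ^ (2 ^ n) * cnj c) < 1" using abs_Re_le_1 False by fastforce
  then show ?thesis
    unfolding min_potential_def using assms by (intro less_imp_le root_potential_less) auto
qed

lemma root_potential_at_midpoint:
  assumes "0 < lam" "lam < 2" "cmod c = 1" "x ^ (2 ^ n) = - c"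
  shows "root_potential lam n c x = max_potential lam n"
proof -
  have "c * cnj c = 1" using assms(3) by (simp add: complex_norm_square[symmetric])
  then have "Re (x ^ (2 ^ n) * cnj c) = - 1" using assms(4) by simp
  moreover have "cmod x = 1" using norm_dyadic_root[of "- c" x n] assms by simp
  ultimately show ?thesis unfolding max_potential_def using assms by (intro root_potential_eq) auto
qed

lemma root_potential_less_max:
  assumes "0 < lam" "lam < 2" "cmod c = 1" "cmod x = 1" "x ^ (2 ^ n) \<noteq> - c"
  shows "root_potential lam n c x < max_potential lam n"
proof -
  let ?w = "x ^ (2 ^ n) * cnj c"
  have w: "cmod ?w = 1" using assms by (simp add: norm_mult norm_power)
  have "Re ?w \<noteq> - 1"
  proof
    assume "Re ?w = - 1"
    then have "?w * c = - c" using unit_eq_minus_1[OF w] by simp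
    moreover have "cnj c * c = 1" using assms(3) by (simp add: complex_norm_square[symmetric] mult.commute)
    ultimately show False using assms(5) by (simp add: mult.assoc)
  qed
  then have "- 1 < Re ?w" using abs_Re_le_1[OF w] by linarith
  then show ?thesis
    unfolding max_potential_def using assms by (intro root_potential_less) auto
qed

lemma root_potential_le_max:
  assumes "0 < lam" "lam < 2" "cmod c = 1" "cmod x = 1"
  shows "root_potential lam n c x \<le> max_potential lam n"
  using root_potential_less_max[OF assms] root_potential_at_midpoint[OF assms(1-3)]
  by (cases "x ^ (2 ^ n) = - c") (auto intro: less_imp_le)

lemma root_potential_Suc:
  assumes "cmod c = 1"
  shows "root_potential lam (Suc n) (c\<^sup>2) x = root_potential lam n c x + root_potential lam n (- c) x"
proof -
  have "z ^ (2 ^ Suc n) = c\<^sup>2 \<longleftrightarrow> z ^ (2 ^ n) = c \<or> z ^ (2 ^ n) = - c" for z :: complex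
    using power2_eq_iff[of "z ^ (2 ^ n)" c] by (simp add: mult.commute flip: power_mult)
  then have "dyadic_roots (Suc n) (c\<^sup>2) = dyadic_roots n c \<union> dyadic_roots n (- c)" by auto
  moreover have "c \<noteq> - c" using assms by auto
  then have "dyadic_roots n c \<inter> dyadic_roots n (- c) = {}" by auto
  ultimately show ?thesis
    unfolding root_potential_def by (simp add: sum.union_disjoint finite_dyadic_roots)
qed

lemma min_potential_Suc: "min_potential lam (Suc n) = min_potential lam n + max_potential lam n"
  using root_potential_Suc[of 1 lam n 1] by (simp add: min_potential_def max_potential_def)

lemma min_potential_0: "min_potential lam 0 = 0"
  by (simp add: min_potential_def root_potential_def)

text \<open>At a midpoint of level \<open>n + 1\<close> the potential splits into two potentials of level \<open>n\<close>, and such a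
  point is a midpoint for neither of them. This yields the strictness of all later inequalities
  without a strict comparison of integrals over the circle.\<close>
lemma max_potential_Suc_less:
  assumes "0 < lam" "lam < 2"
  shows "max_potential lam (Suc n) < 2 * max_potential lam n"
proof -
  have "card (dyadic_roots (Suc n) (- 1)) = 2 ^ Suc n" by (rule card_nth_roots) auto
  then have "dyadic_roots (Suc n) (- 1) \<noteq> {}" by (metis card.empty power_not_zero zero_neq_numeral)
  then obtain x :: complex where x: "x ^ (2 ^ Suc n) = - 1" by (auto simp del: power_Suc)
  then have nx: "cmod x = 1" using norm_dyadic_root[of "- 1" x "Suc n"] by simp
  have "(x ^ (2 ^ n))\<^sup>2 = - 1" using x by (simp add: mult.commute flip: power_mult)
  then have "x ^ (2 ^ n) \<noteq> 1" "x ^ (2 ^ n) \<noteq> - 1" by auto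
  then have "root_potential lam n 1 x < max_potential lam n" "root_potential lam n (- 1) x < max_potential lam n"
    using assms nx by (auto intro!: root_potential_less_max)
  moreover have "max_potential lam (Suc n) = root_potential lam (Suc n) (1\<^sup>2) x"
    using root_potential_at_midpoint[of lam "1" x "Suc n"] assms x by simp
  ultimately show ?thesis by (subst (asm) root_potential_Suc) auto
qed

lemma poisson_oscillation:
  assumes "0 \<le> r" "r < 1"
  shows "poisson r 1 - poisson r (- 1) = 4 * r / (1 - r\<^sup>2)"
proof -
  have a: "1 + r\<^sup>2 - 2 * r * 1 = (1 - r) * (1 - r)" "1 + r\<^sup>2 - 2 * r * (- 1) = (1 + r) * (1 + r)"
    "1 - r\<^sup>2 = (1 - r) * (1 + r)"
    by (simp_all add: power2_eq_square algebra_simps)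
  have "1 - r \<noteq> 0" "1 + r \<noteq> 0" using assms by auto
  then show ?thesis unfolding poisson_def a by (simp add: divide_simps) (simp add: algebra_simps)
qed

text \<open>Every term of the geometric sum \<open>1 + r + \<dots> + r\<^bsup>m-1\<^esup> = (1 - r\<^sup>m) / (1 - r)\<close> is at least
  \<open>r\<^bsup>m-1\<^esup>\<close>. The point is that the bound does not depend on \<open>m\<close>.\<close>
lemma power_mean_bound:
  fixes r :: real
  assumes "0 < r" "r < 1" "0 < m"
  shows "real m * r ^ m / (1 - (r ^ m)\<^sup>2) \<le> r / (1 - r)"
proof -
  have rm: "0 < r ^ m" "r ^ m < 1" using assms by (auto simp: power_less_one_iff)
  have "real m * r ^ m * (1 - r) \<le> r * (1 - r ^ m)"
  proof -
    obtain k where k: "m = Suc k" using assms(3) by (cases m) auto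
    have "real m * r ^ (m - 1) = (\<Sum>i<m. r ^ (m - 1))" by simp
    also have "\<dots> \<le> (\<Sum>i<m. r ^ i)"
      using assms by (intro sum_mono power_decreasing) auto
    finally have "real m * r ^ (m - 1) * (r * (1 - r)) \<le> (\<Sum>i<m. r ^ i) * (r * (1 - r))"
      using assms by (intro mult_right_mono) auto
    moreover have "(\<Sum>i<m. r ^ i) * (1 - r) = 1 - r ^ m"
      using assms by (simp add: sum_gp_strict)
    moreover have "r ^ (m - 1) * r = r ^ m" by (simp add: k)
    ultimately show ?thesis by (metis mult.assoc mult.left_commute)
  qed
  also have "\<dots> \<le> r * (1 - (r ^ m)\<^sup>2)"
    using assms rm by (intro mult_left_mono) (auto simp: power2_eq_square mult_le_cancel_right1)
  finally show ?thesis
    using assms rm by (simp add: divide_le_eq le_divide_eq power_less_one_iff mult.commute)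
qed

text \<open>For fixed \<open>t\<close> the difference of the densities is a multiple of \<open>m r\<^sup>m / (1 - r\<^bsup>2m\<^esup>)\<close> with
  \<open>m = 2\<^sup>n\<close>, which tends to \<open>0\<close>; the bounds \<open>power_mean_bound\<close> and \<open>radius_le\<close> give a majorant of the form
  \<open>4 t\<^bsup>s-1\<^esup> / (1 + t)\<close>.\<close>
lemma oscillation_tendsto_0:
  assumes "0 < lam" "lam < 2"
  shows "(\<lambda>n. max_potential lam n - min_potential lam n) \<longlonglongrightarrow> 0"
proof -
  let ?s = "lam / 2" let ?K = "power_constant ?s"
  let ?f = "\<lambda>n t. weight ?s t * profile n (- 1) t - weight ?s t * profile n 1 t"
  have K: "0 < ?K" using assms by (intro power_constant_pos) auto
  have b: "has_bochner_integral lborel (?f n) (?K * max_potential lam n - ?K * min_potential lam n)" for n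
    using root_potential_representation[of lam "- 1" 1 n] root_potential_representation[of lam 1 1 n] assms
    unfolding max_potential_def min_potential_def by (intro has_bochner_integral_diff) auto
  have f: "?f n t = weight ?s t * ((1 - radius t) / (1 + radius t)
      * (4 * (2 ^ n * radius t ^ (2 ^ n) / (1 - (radius t ^ (2 ^ n))\<^sup>2))))" if "0 < t" for n t
  proof -
    have "?f n t = weight ?s t * ((1 - radius t) / (1 + radius t)
      * (2 ^ n * (poisson (radius t ^ (2 ^ n)) 1 - poisson (radius t ^ (2 ^ n)) (- 1))))"
      by (simp add: profile_def algebra_simps)
    also have "poisson (radius t ^ (2 ^ n)) 1 - poisson (radius t ^ (2 ^ n)) (- 1)
      = 4 * radius t ^ (2 ^ n) / (1 - (radius t ^ (2 ^ n))\<^sup>2)"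
      using radius[OF that] by (intro poisson_oscillation) (auto simp: power_less_one_iff)
    finally show ?thesis by simp
  qed
  have "(\<lambda>n. LINT t|lborel. ?f n t) \<longlonglongrightarrow> (LINT t::real|lborel. (0::real))"
  proof (rule integral_dominated_convergence)
    show "integrable lborel (\<lambda>t. 4 * (weight ?s t / (1 + t)))"
      using assms by (intro integrable_mult_right integrable_weight_over) auto
    show "?f n \<in> borel_measurable lborel" for n
      using b has_bochner_integral_iff borel_measurable_integrable by blast
    show "AE t in lborel. (\<lambda>n. ?f n t) \<longlonglongrightarrow> 0"
    proof (rule AE_I2)
      fix t :: real
      show "(\<lambda>n. ?f n t) \<longlonglongrightarrow> 0"
      proof (cases "0 < t")
        case False then show ?thesis by (simp add: weight_simps)
      next
        case True
        note r = radius[OF True]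
        have sub: "filterlim (\<lambda>n::nat. 2 ^ n :: nat) sequentially sequentially"
          by (rule filterlim_subseq) (simp add: strict_mono_def)
        have "(\<lambda>m. real m * radius t ^ m) \<longlonglongrightarrow> 0" "(\<lambda>m. radius t ^ m) \<longlonglongrightarrow> 0"
          using r powser_times_n_limit_0[of "radius t"] by (auto intro!: LIMSEQ_power_zero)
        then have "(\<lambda>m. real m * radius t ^ m / (1 - (radius t ^ m)\<^sup>2)) \<longlonglongrightarrow> 0 / (1 - 0\<^sup>2)"
          by (intro tendsto_intros) (use r in auto)
        from filterlim_compose[OF this sub]
        have "(\<lambda>n. 2 ^ n * radius t ^ (2 ^ n) / (1 - (radius t ^ (2 ^ n))\<^sup>2)) \<longlonglongrightarrow> 0" by simp
        then show ?thesis unfolding f[OF True] by (intro tendsto_mult_right_zero)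
      qed
    qed
    show "AE t in lborel. norm (?f n t) \<le> 4 * (weight ?s t / (1 + t))" for n
    proof (rule AE_I2)
      fix t :: real
      show "norm (?f n t) \<le> 4 * (weight ?s t / (1 + t))"
      proof (cases "0 < t")
        case False then show ?thesis by (simp add: weight_simps)
      next
        case True
        note r = radius[OF True]
        let ?r = "radius t"
        let ?A = "2 ^ n * ?r ^ (2 ^ n) / (1 - (?r ^ (2 ^ n))\<^sup>2)"
        have "?A \<le> ?r / (1 - ?r)" using power_mean_bound[of ?r "2 ^ n"] r by simp
        then have "(1 - ?r) / (1 + ?r) * (4 * ?A) \<le> (1 - ?r) / (1 + ?r) * (4 * (?r / (1 - ?r)))"
          using r by (intro mult_left_mono) auto
        also have "\<dots> = 4 * (?r / (1 + ?r))"
        proof -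
          have "1 - ?r \<noteq> 0" using r by simp
          then show ?thesis by simp
        qed
        also have "\<dots> \<le> 4 * (?r / 1)" using r by (intro mult_left_mono divide_left_mono) auto
        also have "\<dots> \<le> 4 * (1 / (1 + t))" using radius_le[OF True] by simp
        finally have "weight ?s t * ((1 - ?r) / (1 + ?r) * (4 * ?A)) \<le> weight ?s t * (4 * (1 / (1 + t)))"
          by (intro mult_left_mono weight_nonneg)
        moreover have "0 \<le> ?f n t"
        proof -
          have "0 \<le> ?A" using r by (intro divide_nonneg_nonneg) (auto simp: power_le_one)
          then show ?thesis unfolding f[OF True]
            using r by (intro mult_nonneg_nonneg weight_nonneg) auto
        qed
        moreover have "weight ?s t * (4 * (1 / (1 + t))) = 4 * (weight ?s t / (1 + t))" by simp
        ultimately show ?thesis by (simp only: real_norm_def abs_of_nonneg f[OF True, of n])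
      qed
    qed
  qed simp
  then have "(\<lambda>n. inverse ?K * (?K * max_potential lam n - ?K * min_potential lam n)) \<longlonglongrightarrow> inverse ?K * 0"
    unfolding has_bochner_integral_integral_eq[OF b] by (intro tendsto_mult_left) simp
  moreover have "inverse ?K * (?K * max_potential lam n - ?K * min_potential lam n)
    = max_potential lam n - min_potential lam n" for n
    using K by (simp add: field_simps)
  ultimately show ?thesis by simp
qed

section \<open>Averages over the circle\<close>

lemma measurable_cis_circle: "cis \<in> measurable (uniform_measure lborel {0..2 * pi}) (restrict_space borel unit_circle)"
proof (rule measurable_restrict_space2)
  have "cis \<in> borel_measurable borel" by (intro borel_measurable_continuous_onI continuous_intros)
  then show "cis \<in> borel_measurable (uniform_measure lborel {0..2 * pi})"
    by (simp cong: measurable_cong_sets)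
qed simp

lemma space_circle_measure: "space circle_measure = unit_circle"
  by (simp add: circle_measure_def space_restrict_space)

lemma sets_circle_measure: "sets circle_measure = sets (restrict_space borel unit_circle)"
  by (simp add: circle_measure_def)

lemma borel_measurable_circle:
  "f \<in> borel_measurable borel \<Longrightarrow> f \<in> borel_measurable circle_measure"
  by (subst measurable_cong_sets[OF sets_circle_measure refl]) (rule measurable_restrict_space1)

lemma emeasure_circle_measure: "emeasure circle_measure (space circle_measure) = 1"
proof -
  have [simp]: "cis -` unit_circle = UNIV" by auto
  have "emeasure circle_measure (space circle_measure)
    = emeasure (uniform_measure lborel {0..2 * pi}) (cis -` unit_circle \<inter> space (uniform_measure lborel {0..2 * pi}))"
    unfolding space_circle_measure unfolding circle_measure_def
    by (rule emeasure_distr[OF measurable_cis_circle]) (auto simp: sets_restrict_space)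
  also have "\<dots> = 1" by (simp add: divide_ennreal ennreal_divide_self)
  finally show ?thesis .
qed

lemma finite_circle_measure: "finite_measure circle_measure"
  by (rule finite_measureI) (simp add: emeasure_circle_measure)

lemma measure_circle_measure: "measure circle_measure (space circle_measure) = 1"
  by (simp add: measure_def emeasure_circle_measure)

lemma integral_circle_measure:
  fixes g :: "complex \<Rightarrow> real"
  assumes "continuous_on UNIV g"
  shows "(LINT x|circle_measure. g x) = integral {0..2 * pi} (\<lambda>t. g (cis t)) / (2 * pi)"
proof -
  have m: "g \<in> borel_measurable borel" using assms by (rule borel_measurable_continuous_onI)
  have c: "continuous_on A (\<lambda>t. g (cis t))" for A
    by (rule continuous_on_compose2[OF assms]) (auto intro!: continuous_intros)
  then have mc: "(\<lambda>t. g (cis t)) \<in> borel_measurable borel" by (rule borel_measurable_continuous_onI)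
  have "(LINT x|circle_measure. g x) = (LINT t|uniform_measure lborel {0..2 * pi}. g (cis t))"
    unfolding circle_measure_def
    using measurable_cis_circle measurable_restrict_space1[OF m] by (rule integral_distr)
  also have "uniform_measure lborel {0..2 * pi}
    = density lborel (\<lambda>t. ennreal (indicator {0..2 * pi} t / (2 * pi)))"
    unfolding uniform_measure_def
    by (intro arg_cong[where f = "density lborel"] ext) (auto simp: indicator_def divide_ennreal simp flip: ennreal_1)
  also have "(LINT t|\<dots>. g (cis t)) = (LINT t|lborel. (indicator {0..2 * pi} t / (2 * pi)) *\<^sub>R g (cis t))"
    using mc by (intro integral_density) auto
  also have "\<dots> = (LINT t:{0..2 * pi}|lborel. g (cis t)) / (2 * pi)"
    unfolding set_lebesgue_integral_def by (simp flip: integral_divide_zero)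
  also have "(LINT t:{0..2 * pi}|lborel. g (cis t)) = integral {0..2 * pi} (\<lambda>t. g (cis t))"
    by (intro set_borel_integral_eq_integral borel_integrable_atLeastAtMost' c)
  finally show ?thesis .
qed

text \<open>The part of the shifted interval beyond \<open>p\<close> is moved back by one period.\<close>
lemma integral_periodic_shift:
  fixes f :: "real \<Rightarrow> real"
  assumes "continuous_on UNIV f" "\<And>t. f (t + p) = f t" "0 \<le> s" "s \<le> p"
  shows "integral {0..p} (\<lambda>t. f (s + t)) = integral {0..p} f"
proof -
  have i: "f integrable_on {a..b}" for a b
    by (rule integrable_continuous_interval) (rule continuous_on_subset[OF assms(1)], simp)
  have shift: "integral {a..b} (\<lambda>t. f (c + t)) = integral {a + c..b + c} f" for a b c
    using has_integral_shift_cbox_iff[of f c "integral {a + c..b + c} f" a b] integrable_integral[OF i]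
    by (auto simp: o_def intro: integral_unique)
  have "integral {0..p} (\<lambda>t. f (s + t)) = integral {s..p + s} f" using shift[of 0 p s] by simp
  also have "\<dots> = integral {s..p} f + integral {p..p + s} f"
    using assms by (intro Henstock_Kurzweil_Integration.integral_combine[symmetric] i) auto
  also have "integral {p..p + s} f = integral {0..s} (\<lambda>t. f (p + t))" using shift[of 0 s p] by (simp add: add.commute)
  also have "\<dots> = integral {0..s} f" using assms(2) by (simp add: add.commute)
  also have "integral {s..p} f + \<dots> = integral {0..p} f"
    using assms Henstock_Kurzweil_Integration.integral_combine[of 0 s p f] i by simp
  finally show ?thesis .
qed

lemma integral_circle_measure_rotate:
  fixes g :: "complex \<Rightarrow> real"
  assumes "continuous_on UNIV g" "cmod c = 1"
  shows "(LINT x|circle_measure. g (c * x)) = (LINT x|circle_measure. g x)"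
proof -
  obtain s where s: "0 \<le> s" "s < 2 * pi" "c = cis s"
    using complex_unimodular_polar[OF assms(2)] by (metis complex.collapse cis.code)
  have 1: "continuous_on UNIV (\<lambda>x. g (c * x))"
    by (rule continuous_on_compose2[OF assms(1)]) (auto intro!: continuous_intros)
  have 2: "continuous_on UNIV (\<lambda>t. g (cis t))"
    by (rule continuous_on_compose2[OF assms(1)]) (auto intro!: continuous_intros)
  have "integral {0..2 * pi} (\<lambda>t. g (c * cis t)) = integral {0..2 * pi} (\<lambda>t. g (cis (s + t)))"
    by (simp add: s cis_mult)
  also have "\<dots> = integral {0..2 * pi} (\<lambda>t. g (cis t))"
    using s by (intro integral_periodic_shift[OF 2]) (auto simp flip: cis_mult)
  finally show ?thesis by (simp add: integral_circle_measure[OF 1] integral_circle_measure[OF assms(1)])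
qed

lemma continuous_on_dist_powr:
  assumes "0 < lam" shows "continuous_on A (\<lambda>x. cmod (x - z) powr lam)"
  using assms by (intro continuous_on_powr' continuous_intros) auto

text \<open>By rotation invariance the potential of the uniform measure is constant on the circle, so it equals
  its own average, which by Fubini is the energy.\<close>
lemma integral_dist_powr_circle:
  assumes "0 < lam" "cmod z = 1"
  shows "(LINT x|circle_measure. cmod (x - z) powr lam) = riesz_energy lam circle_measure"
proof -
  interpret finite_measure circle_measure by (rule finite_circle_measure)
  interpret pair_sigma_finite circle_measure circle_measure ..
  let ?J = "LINT x|circle_measure. cmod (x - 1) powr lam"
  have rot: "(LINT x|circle_measure. cmod (x - w) powr lam) = ?J" if "cmod w = 1" for w
  proof -
    have "cmod (w * x - w) = cmod (x - 1)" for x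
    proof -
      have "w * x - w = w * (x - 1)" by (simp add: algebra_simps)
      then show ?thesis using that by (simp add: norm_mult)
    qed
    then show ?thesis
      using integral_circle_measure_rotate[OF continuous_on_dist_powr[OF assms(1), of UNIV w] that] by simp
  qed
  let ?f = "\<lambda>p. cmod (fst p - snd p) powr lam"
  have id: "(\<lambda>x. x) \<in> borel_measurable circle_measure" by (intro borel_measurable_circle) simp
  have "integrable (circle_measure \<Otimes>\<^sub>M circle_measure) ?f"
  proof (rule finite_measure.integrable_const_bound)
    show "finite_measure (circle_measure \<Otimes>\<^sub>M circle_measure)"
      by (intro finite_measure_pair_measure finite_circle_measure)
    have [measurable]: "fst \<in> borel_measurable (circle_measure \<Otimes>\<^sub>M circle_measure)"
      "snd \<in> borel_measurable (circle_measure \<Otimes>\<^sub>M circle_measure)"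
      using measurable_compose[OF measurable_fst id] measurable_compose[OF measurable_snd id] by auto
    show "?f \<in> borel_measurable (circle_measure \<Otimes>\<^sub>M circle_measure)" by measurable
    show "AE p in circle_measure \<Otimes>\<^sub>M circle_measure. norm (?f p) \<le> 2 powr lam"
    proof (rule AE_I2)
      fix p assume "p \<in> space (circle_measure \<Otimes>\<^sub>M circle_measure)"
      then have "cmod (fst p) = 1" "cmod (snd p) = 1"
        by (auto simp: space_pair_measure space_circle_measure)
      then have "cmod (fst p - snd p) \<le> 2" using norm_triangle_ineq4[of "fst p" "snd p"] by simp
      then show "norm (?f p) \<le> 2 powr lam" using assms by (simp add: powr_mono2)
    qed
  qed
  from integral_fst'[OF this]
  have "riesz_energy lam circle_measure = (LINT x|circle_measure. LINT y|circle_measure. cmod (x - y) powr lam)"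
    by (simp add: riesz_energy_def case_prod_unfold)
  also have "\<dots> = (LINT x|circle_measure. ?J)"
    by (rule Bochner_Integration.integral_cong[OF refl], subst norm_minus_commute, rule rot)
      (simp add: space_circle_measure)
  also have "\<dots> = ?J" by (simp add: measure_circle_measure)
  finally show ?thesis using rot[OF assms(2)] by simp
qed

lemma integrable_circle_measure:
  fixes g :: "complex \<Rightarrow> real"
  assumes "continuous_on UNIV g"
  shows "integrable circle_measure g"
proof -
  have "compact (g ` unit_circle)"
    by (intro compact_continuous_image continuous_on_subset[OF assms]) auto
  then obtain B where "\<forall>x\<in>unit_circle. norm (g x) \<le> B"
    using compact_imp_bounded bounded_iff by (metis imageI)
  then have "AE x in circle_measure. norm (g x) \<le> B"
    by (intro AE_I2) (simp add: space_circle_measure)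
  moreover have "g \<in> borel_measurable circle_measure"
    by (intro borel_measurable_circle borel_measurable_continuous_onI assms)
  ultimately show ?thesis by (rule finite_measure.integrable_const_bound[OF finite_circle_measure])
qed

lemma integral_root_potential:
  assumes "0 < lam"
  shows "(LINT x|circle_measure. root_potential lam n 1 x) = 2 ^ n * riesz_energy lam circle_measure"
proof -
  have "(LINT x|circle_measure. root_potential lam n 1 x)
    = (\<Sum>z\<in>dyadic_roots n 1. LINT x|circle_measure. cmod (x - z) powr lam)"
    unfolding root_potential_def
    by (intro Bochner_Integration.integral_sum integrable_circle_measure continuous_on_dist_powr assms)
  also have "\<dots> = (\<Sum>z\<in>dyadic_roots n 1. riesz_energy lam circle_measure)"
    using assms by (intro sum.cong refl integral_dist_powr_circle) (auto intro: norm_dyadic_root[of 1])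
  also have "card (dyadic_roots n 1) = 2 ^ n" by (rule card_nth_roots) auto
  ultimately show ?thesis by simp
qed

text \<open>An average lies between the least and the largest value.\<close>
lemma energy_between:
  assumes "0 < lam" "lam < 2"
  shows "min_potential lam n \<le> 2 ^ n * riesz_energy lam circle_measure"
    and "2 ^ n * riesz_energy lam circle_measure \<le> max_potential lam n"
proof -
  have i: "integrable circle_measure (root_potential lam n 1)"
    unfolding root_potential_def using assms
    by (intro integrable_circle_measure continuous_on_sum continuous_on_dist_powr)
  have m: "Sigma_Algebra.measure circle_measure (space circle_measure) = 1"
    by (rule measure_circle_measure)
  have c: "(LINT x|circle_measure. k) = k" "integrable circle_measure (\<lambda>x. k)" for k :: real
    using finite_measure.integrable_const[OF finite_circle_measure]
    by (simp_all add: measure_circle_measure)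
  have "(LINT x|circle_measure. min_potential lam n) \<le> (LINT x|circle_measure. root_potential lam n 1 x)"
    using assms by (intro integral_mono i c root_potential_ge_min) (auto simp: space_circle_measure)
  then show "min_potential lam n \<le> 2 ^ n * riesz_energy lam circle_measure"
    using assms by (simp add: m integral_root_potential)
  have "(LINT x|circle_measure. root_potential lam n 1 x) \<le> (LINT x|circle_measure. max_potential lam n)"
    using assms by (intro integral_mono i c root_potential_le_max) (auto simp: space_circle_measure)
  then show "2 ^ n * riesz_energy lam circle_measure \<le> max_potential lam n"
    using assms by (simp add: m integral_root_potential)
qed

text \<open>The weak inequality one level up, combined with the strict inequality between the levels.\<close>
lemma energy_less_max:
  assumes "0 < lam" "lam < 2"
  shows "2 ^ n * riesz_energy lam circle_measure < max_potential lam n"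
  using energy_between(2)[OF assms, of "Suc n"] max_potential_Suc_less[OF assms, of n]
  by simp

text \<open>Up to the factor \<open>2\<^sup>n\<close>, the error of the quadrature rule with the dyadic roots of \<open>1\<close> as nodes
  for the function \<open>|1 - x|\<^sup>\<lambda>\<close>. The consecutive differences of the deficits are the building blocks
  of the excess of a greedy sequence.\<close>
definition deficit :: "real \<Rightarrow> nat \<Rightarrow> real"
  where "deficit lam n = 2 ^ n * riesz_energy lam circle_measure - min_potential lam n"

lemma max_potential_deficit:
  "max_potential lam n - 2 ^ n * riesz_energy lam circle_measure = deficit lam n - deficit lam (Suc n)"
  by (simp add: deficit_def min_potential_Suc)

lemma deficit_Suc_less:
  assumes "0 < lam" "lam < 2" shows "deficit lam (Suc n) < deficit lam n"
  using energy_less_max[OF assms, of n] max_potential_deficit[of lam n] by simp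

lemma deficit_pos:
  assumes "0 < lam" "lam < 2" shows "0 < deficit lam n"
  using deficit_Suc_less[OF assms, of n] energy_between(1)[OF assms, of "Suc n"]
  by (simp only: deficit_def)

lemma deficit_0: "deficit lam 0 = riesz_energy lam circle_measure"
  by (simp add: deficit_def min_potential_0)

lemma deficit_tendsto_0:
  assumes "0 < lam" "lam < 2" shows "deficit lam \<longlonglongrightarrow> 0"
proof (rule tendsto_sandwich[OF _ _ tendsto_const oscillation_tendsto_0[OF assms]])
  show "\<forall>\<^sub>F n in sequentially. 0 \<le> deficit lam n"
    using deficit_pos[OF assms] by (simp add: less_imp_le)
  show "\<forall>\<^sub>F n in sequentially. deficit lam n \<le> max_potential lam n - min_potential lam n"
    using energy_between(2)[OF assms] by (simp add: deficit_def)
qed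

section \<open>Structure of greedy sequences\<close>

text \<open>Finite greedy sequences are needed because the induction modifies and shifts sequences, and a
  shifted sequence is only known to be greedy up to a bounded length. For \<open>k = 0\<close> the potential is an
  empty sum, so the first point is an arbitrary point of the circle.\<close>
definition greedy_prefix :: "real \<Rightarrow> (nat \<Rightarrow> complex) \<Rightarrow> nat \<Rightarrow> bool"
  where "greedy_prefix lam b m \<longleftrightarrow> (\<forall>k<m. cmod (b k) = 1 \<and>
    (\<forall>x. cmod x = 1 \<longrightarrow> riesz_potential lam b k x \<le> riesz_potential lam b k (b k)))"

lemma greedy_prefix_mono: "greedy_prefix lam b m \<Longrightarrow> k \<le> m \<Longrightarrow> greedy_prefix lam b k"
  by (simp add: greedy_prefix_def)

lemma riesz_potential_cong:
  "(\<And>k. k < m \<Longrightarrow> b k = b' k) \<Longrightarrow> riesz_potential lam b m = riesz_potential lam b' m"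
  by (simp add: riesz_potential_def fun_eq_iff)

lemma riesz_potential_add:
  "riesz_potential lam b (M + m) x = riesz_potential lam b M x + riesz_potential lam (\<lambda>k. b (M + k)) m x"
  by (induction m) (simp_all add: riesz_potential_def)

lemma riesz_potential_eq_root_potential:
  assumes "inj_on b {..<2 ^ n}" "\<And>k. k < 2 ^ n \<Longrightarrow> b k ^ (2 ^ n) = c" "cmod c = 1"
  shows "riesz_potential lam b (2 ^ n) x = root_potential lam n c x"
proof -
  have "c \<noteq> 0" using assms(3) by auto
  then have "card (dyadic_roots n c) = 2 ^ n" by (intro card_nth_roots) auto
  then have "b ` {..<2 ^ n} = dyadic_roots n c"
    using assms(1,2) by (intro card_subset_eq finite_dyadic_roots) (auto simp: card_image)
  then show ?thesis
    unfolding riesz_potential_def root_potential_def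
    using sum.reindex[OF assms(1), of "\<lambda>z. cmod (x - z) powr lam"] by simp
qed

lemma riesz_potential_attains_max:
  assumes "0 < lam"
  obtains y where "cmod y = 1" "\<And>x. cmod x = 1 \<Longrightarrow> riesz_potential lam b m x \<le> riesz_potential lam b m y"
proof -
  have "continuous_on unit_circle (riesz_potential lam b m)"
    unfolding riesz_potential_def by (intro continuous_on_sum continuous_on_dist_powr assms)
  moreover have "unit_circle \<noteq> {}" by (auto intro!: exI[of _ 1])
  ultimately obtain y where "y \<in> unit_circle" "\<forall>x\<in>unit_circle. riesz_potential lam b m x \<le> riesz_potential lam b m y"
    using continuous_attains_sup[OF compact_sphere] by meson
  then show ?thesis using that[of y] by simp
qed

text \<open>The induction statement on the level: up to length \<open>2\<^sup>n\<close> every greedy sequence runs through distinct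
  dyadic roots of one number, and at length \<open>2\<^sup>n\<close> it has exhausted them.\<close>
definition fills_dyadic_roots :: "real \<Rightarrow> nat \<Rightarrow> bool"
  where "fills_dyadic_roots lam n \<longleftrightarrow> (\<forall>b m. greedy_prefix lam b m \<longrightarrow> m \<le> 2 ^ n \<longrightarrow>
    inj_on b {..<m} \<and> (\<forall>k<m. b k ^ (2 ^ n) = b 0 ^ (2 ^ n)))"

text \<open>After a full first block the potential is the potential of dyadic roots plus that of the tail. To
  see that both are maximized simultaneously, extend the tail by any maximizer \<open>y\<close> of its own
  potential. The extended tail is greedy and no longer than \<open>2\<^sup>n\<close>, so \<open>y\<close> is again a midpoint of the
  first block. The value at \<open>y\<close> is thus the sum of the two maxima, and the actual greedy point, being
  at least as good, must attain both.\<close>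
lemma greedy_prefix_tail:
  assumes lam: "0 < lam" "lam < 2" and fills: "fills_dyadic_roots lam n"
    and greedy: "greedy_prefix lam b (2 ^ n + m)" and "m \<le> 2 ^ n"
  defines "b' \<equiv> \<lambda>k. b (2 ^ n + k)"
  shows "greedy_prefix lam b' m"
    and "k < m \<Longrightarrow> b' k ^ (2 ^ n) = - (b 0 ^ (2 ^ n))"
    and "k < m \<Longrightarrow> riesz_potential lam b (2 ^ n + k) (b (2 ^ n + k))
      = max_potential lam n + riesz_potential lam b' k (b' k)"
proof -
  define c where "c = b 0 ^ (2 ^ n)"
  have "cmod (b 0) = 1" using greedy by (simp add: greedy_prefix_def)
  then have c: "cmod c = 1" by (simp add: c_def norm_power)
  have first: "riesz_potential lam b (2 ^ n) x = root_potential lam n c x" for x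
  proof -
    have "greedy_prefix lam b (2 ^ n)" using greedy by (rule greedy_prefix_mono) simp
    then have "inj_on b {..<2 ^ n}" "\<forall>k<2 ^ n. b k ^ (2 ^ n) = c"
      using fills unfolding fills_dyadic_roots_def c_def by blast+
    then show ?thesis using c by (intro riesz_potential_eq_root_potential) auto
  qed
  have "greedy_prefix lam b' m \<and> (\<forall>k<m. b' k ^ (2 ^ n) = - c \<and>
      riesz_potential lam b (2 ^ n + k) (b' k) = max_potential lam n + riesz_potential lam b' k (b' k))"
    using greedy \<open>m \<le> 2 ^ n\<close>
  proof (induction m)
    case 0 then show ?case by (simp add: greedy_prefix_def)
  next
    case (Suc m)
    have IH: "greedy_prefix lam b' m" "\<And>k. k < m \<Longrightarrow> b' k ^ (2 ^ n) = - c"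
      "\<And>k. k < m \<Longrightarrow> riesz_potential lam b (2 ^ n + k) (b' k) = max_potential lam n + riesz_potential lam b' k (b' k)"
      using Suc greedy_prefix_mono[OF Suc.prems(1), of "2 ^ n + m"] by auto
    \<comment> \<open>an empty tail has constant potential, so any midpoint will do; otherwise extend the tail\<close>
    obtain y where y: "y ^ (2 ^ n) = - c"
      "\<And>x. cmod x = 1 \<Longrightarrow> riesz_potential lam b' m x \<le> riesz_potential lam b' m y"
    proof (cases "m = 0")
      case True
      have "card (dyadic_roots n (- c)) = 2 ^ n" using c by (intro card_nth_roots) auto
      then have "dyadic_roots n (- c) \<noteq> {}" by (metis card.empty power_not_zero zero_neq_numeral)
      then obtain y where "y ^ (2 ^ n) = - c" by auto
      then show ?thesis using that[of y] True by (simp add: riesz_potential_def)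
    next
      case False
      obtain y where y: "cmod y = 1" "\<And>x. cmod x = 1 \<Longrightarrow> riesz_potential lam b' m x \<le> riesz_potential lam b' m y"
        using riesz_potential_attains_max[OF lam(1)] by blast
      have "riesz_potential lam (b'(m := y)) k = riesz_potential lam b' k" if "k \<le> m" for k
        using that by (intro riesz_potential_cong) auto
      then have "greedy_prefix lam (b'(m := y)) (Suc m)"
        using IH(1) y by (auto simp: greedy_prefix_def less_Suc_eq)
      then have "(b'(m := y)) m ^ (2 ^ n) = (b'(m := y)) 0 ^ (2 ^ n)"
        using fills Suc.prems(2) unfolding fills_dyadic_roots_def by (metis lessI)
      then have "y ^ (2 ^ n) = - c" using False IH(2)[of 0] by simp
      then show ?thesis using that y(2) by blast
    qed
    have ny: "cmod y = 1" using norm_dyadic_root[of "- c" y n] c y(1) by simp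
    have split: "riesz_potential lam b (2 ^ n + m) x = root_potential lam n c x + riesz_potential lam b' m x" for x
      by (simp add: riesz_potential_add first b'_def)
    have nb: "cmod (b' m) = 1"
      and best: "riesz_potential lam b (2 ^ n + m) y \<le> riesz_potential lam b (2 ^ n + m) (b' m)"
      using Suc.prems(1) ny by (auto simp: greedy_prefix_def b'_def)
    have le: "max_potential lam n + riesz_potential lam b' m y
        \<le> root_potential lam n c (b' m) + riesz_potential lam b' m (b' m)"
      using best unfolding split by (simp add: root_potential_at_midpoint[OF lam c y(1)])
    have eq: "b' m ^ (2 ^ n) = - c"
      using root_potential_less_max[OF lam c nb] le y(2)[OF nb] by fastforce
    have max: "riesz_potential lam b' m x \<le> riesz_potential lam b' m (b' m)" if "cmod x = 1" for x
      using y(2)[OF that] le by (simp add: root_potential_at_midpoint[OF lam c eq])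
    have "greedy_prefix lam b' (Suc m)"
      using IH(1) nb max by (auto simp: greedy_prefix_def less_Suc_eq)
    moreover have "riesz_potential lam b (2 ^ n + m) (b' m) = max_potential lam n + riesz_potential lam b' m (b' m)"
      by (simp add: split root_potential_at_midpoint[OF lam c eq])
    ultimately show ?case using IH(2,3) eq by (auto simp: less_Suc_eq)
  qed
  then show "greedy_prefix lam b' m"
    and "k < m \<Longrightarrow> b' k ^ (2 ^ n) = - (b 0 ^ (2 ^ n))"
    and "k < m \<Longrightarrow> riesz_potential lam b (2 ^ n + k) (b (2 ^ n + k))
      = max_potential lam n + riesz_potential lam b' k (b' k)"
    by (auto simp: c_def b'_def)
qed

text \<open>Going up one level: the first block consists of roots of \<open>c\<close> and the tail of roots of \<open>- c\<close>, where
  \<open>c\<close> is the \<open>2\<^sup>n\<close>-th power of the first point. These sets are disjoint, and both consist of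
  roots of \<open>c\<^sup>2\<close> at the next level.\<close>
lemma greedy_fills_dyadic_roots:
  assumes lam: "0 < lam" "lam < 2"
  shows "fills_dyadic_roots lam n"
proof (induction n)
  case 0
  then show ?case by (auto simp: fills_dyadic_roots_def le_Suc_eq inj_on_def)
next
  case (Suc n)
  show ?case unfolding fills_dyadic_roots_def
  proof (intro allI impI)
    fix b m assume greedy: "greedy_prefix lam b m" and m: "m \<le> 2 ^ Suc n"
    define c where "c = b 0 ^ (2 ^ n)"
    let ?l = "min m (2 ^ n)"
    have "greedy_prefix lam b ?l" using greedy by (rule greedy_prefix_mono) simp
    moreover have "?l \<le> 2 ^ n" by simp
    ultimately have low: "inj_on b {..<?l}" "\<And>k. k < ?l \<Longrightarrow> b k ^ (2 ^ n) = c"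
      using Suc.IH unfolding fills_dyadic_roots_def c_def by blast+
    have pow: "z ^ (2 ^ Suc n) = c\<^sup>2" if "z ^ (2 ^ n) = c \<or> z ^ (2 ^ n) = - c" for z
    proof -
      have "z ^ (2 ^ Suc n) = (z ^ (2 ^ n))\<^sup>2" by (simp add: mult.commute flip: power_mult)
      then show ?thesis using that by auto
    qed
    have base: "b 0 ^ (2 ^ Suc n) = c\<^sup>2" by (rule pow) (simp add: c_def)
    show "inj_on b {..<m} \<and> (\<forall>k<m. b k ^ (2 ^ Suc n) = b 0 ^ (2 ^ Suc n))"
    proof (cases "m \<le> 2 ^ n")
      case True
      then have "?l = m" by simp
      then have "b k ^ (2 ^ Suc n) = c\<^sup>2" if "k < m" for k
        using low(2)[of k] that by (intro pow) simp
      then show ?thesis using low(1) \<open>?l = m\<close> base by simp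
    next
      case False
      define j where "j = m - 2 ^ n"
      have j: "m = 2 ^ n + j" "j \<le> 2 ^ n" using False m by (auto simp: j_def)
      let ?b = "\<lambda>k. b (2 ^ n + k)"
      note tail = greedy_prefix_tail[OF lam Suc.IH greedy[unfolded j(1)] j(2), folded c_def]
      have high: "b k ^ (2 ^ n) = - c" if "k < m" "\<not> k < 2 ^ n" for k
        using tail(2)[of "k - 2 ^ n"] that j(1) by simp
      have "cmod (b 0) = 1" using greedy False by (simp add: greedy_prefix_def)
      then have "c \<noteq> - c" by (auto simp: c_def)
      have "inj_on ?b {..<j}" using Suc.IH tail(1) j(2) unfolding fills_dyadic_roots_def by blast
      have "?l = 2 ^ n" using False by simp
      note low = low[unfolded this]
      have "inj_on b {..<m}"
      proof (rule inj_onI)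
        fix k l assume kl: "k \<in> {..<m}" "l \<in> {..<m}" "b k = b l"
        have same: "k < 2 ^ n \<longleftrightarrow> l < 2 ^ n"
          using kl high low(2) \<open>c \<noteq> - c\<close> by (metis lessThan_iff)
        show "k = l"
        proof (cases "k < 2 ^ n")
          case True
          then show ?thesis using same inj_onD[OF low(1) kl(3)] by simp
        next
          case k: False
          then have "k - 2 ^ n = l - 2 ^ n"
            using kl same j(1) by (intro inj_onD[OF \<open>inj_on ?b {..<j}\<close>]) auto
          then show ?thesis using k same by simp
        qed
      qed
      moreover have "b k ^ (2 ^ Suc n) = c\<^sup>2" if "k < m" for k
        by (rule pow) (use low(2)[of k] high[OF that] in blast)
      ultimately show ?thesis using base by simp
    qed
  qed
qed

section \<open>The excess over the energy\<close>

definition excess :: "real \<Rightarrow> (nat \<Rightarrow> complex) \<Rightarrow> nat \<Rightarrow> real"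
  where "excess lam b m = riesz_potential lam b m (b m) - real m * riesz_energy lam circle_measure"

lemma excess_add_power:
  assumes "0 < lam" "lam < 2" "greedy_prefix lam b (2 ^ n + Suc m)" "m < 2 ^ n"
  shows "greedy_prefix lam (\<lambda>k. b (2 ^ n + k)) (Suc m)"
    and "excess lam b (2 ^ n + m) = deficit lam n - deficit lam (Suc n) + excess lam (\<lambda>k. b (2 ^ n + k)) m"
proof -
  note tail = greedy_prefix_tail[OF assms(1,2) greedy_fills_dyadic_roots[OF assms(1,2)] assms(3)]
  show "greedy_prefix lam (\<lambda>k. b (2 ^ n + k)) (Suc m)" using tail(1) assms(4) by simp
  show "excess lam b (2 ^ n + m) = deficit lam n - deficit lam (Suc n) + excess lam (\<lambda>k. b (2 ^ n + k)) m"
    unfolding max_potential_deficit[symmetric]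
    using tail(3)[of m] assms(4) by (simp add: excess_def algebra_simps)
qed

lemma excess_0: "excess lam b 0 = 0"
  by (simp add: excess_def riesz_potential_def)

text \<open>Splitting off the leading binary digit of \<open>m\<close> adds one difference of deficits. The upper bound
  corresponds to all digits being \<open>1\<close> and telescopes. The statement covers all greedy sequences at once
  because the step passes from a sequence to its tail.\<close>
lemma excess_bounds:
  assumes lam: "0 < lam" "lam < 2" and "greedy_prefix lam b (Suc m)" "m < 2 ^ n"
  shows "0 \<le> excess lam b m" "excess lam b m \<le> deficit lam 0 - deficit lam n"
    "0 < m \<Longrightarrow> 0 < excess lam b m" "m = 2 ^ n - 1 \<Longrightarrow> excess lam b m = deficit lam 0 - deficit lam n"
proof -
  have "0 \<le> excess lam b m \<and> excess lam b m \<le> deficit lam 0 - deficit lam n \<and>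
    (0 < m \<longrightarrow> 0 < excess lam b m) \<and> (m = 2 ^ n - 1 \<longrightarrow> excess lam b m = deficit lam 0 - deficit lam n)"
    using assms(3,4)
  proof (induction n arbitrary: b m)
    case 0 then show ?case by (simp add: excess_0)
  next
    case (Suc n)
    note d = deficit_Suc_less[OF lam, of n]
    show ?case
    proof (cases "m < 2 ^ n")
      case True
      then have "m \<noteq> 2 ^ Suc n - 1" by simp
      then show ?thesis using Suc.IH[OF Suc.prems(1) True] d by auto
    next
      case False
      define k where "k = m - 2 ^ n"
      have k: "m = 2 ^ n + k" "k < 2 ^ n" using False Suc.prems(2) by (auto simp: k_def)
      note step = excess_add_power[OF lam, of b n k]
      have "greedy_prefix lam b (2 ^ n + Suc k)" using Suc.prems(1) k by simp
      note step = step[OF this k(2)]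
      have "m = 2 ^ Suc n - 1 \<longleftrightarrow> k = 2 ^ n - 1" using k by auto
      moreover have "0 \<le> excess lam (\<lambda>k. b (2 ^ n + k)) k \<and>
          excess lam (\<lambda>k. b (2 ^ n + k)) k \<le> deficit lam 0 - deficit lam n \<and>
          (k = 2 ^ n - 1 \<longrightarrow> excess lam (\<lambda>k. b (2 ^ n + k)) k = deficit lam 0 - deficit lam n)"
        using Suc.IH[OF step(1) k(2)] by blast
      moreover have "excess lam b m = deficit lam n - deficit lam (Suc n) + excess lam (\<lambda>k. b (2 ^ n + k)) k"
        using step(2) k(1) by simp
      ultimately show ?thesis using d by linarith
    qed
  qed
  then show "0 \<le> excess lam b m" "excess lam b m \<le> deficit lam 0 - deficit lam n"
    "0 < m \<Longrightarrow> 0 < excess lam b m" "m = 2 ^ n - 1 \<Longrightarrow> excess lam b m = deficit lam 0 - deficit lam n"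
    by auto
qed

theorem theorem3p11:
  fixes lam :: real and a :: "nat \<Rightarrow> complex"
  defines "I \<equiv> riesz_energy lam circle_measure"
  defines "D \<equiv> (\<lambda>N. riesz_potential lam a N (a N) - real N * I)"
  assumes "0 < lam" and "lam < 2"
    and "greedy_energy_sequence lam a" and "a 0 = 1"
  shows "bounded (D ` {1..}) \<and> \<not> convergent D
    \<and> (\<forall>N\<ge>1. 0 < D N \<and> D N < I)
    \<and> liminf (\<lambda>N. ereal (D N)) = 0
    \<and> limsup (\<lambda>N. ereal (D N)) = ereal I"
proof -
  note lam = \<open>0 < lam\<close> \<open>lam < 2\<close>
  have D: "D = excess lam a" by (simp add: D_def I_def excess_def fun_eq_iff)
  have I: "I = deficit lam 0" by (simp add: I_def deficit_0)
  have greedy: "greedy_prefix lam a m" for m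
    unfolding greedy_prefix_def
  proof (intro allI impI conjI)
    fix k and x :: complex assume "cmod x = 1"
    then show "riesz_potential lam a k x \<le> riesz_potential lam a k (a k)"
      using assms(5) by (cases "k = 0") (auto simp: greedy_energy_sequence_def riesz_potential_def)
  qed (use assms(5) in \<open>simp add: greedy_energy_sequence_def\<close>)
  have less: "N < 2 ^ N" for N :: nat by (rule less_exp)
  have nonneg: "0 \<le> D N" for N
    unfolding D by (rule excess_bounds(1)[OF lam greedy less])
  have pos: "0 < D N" if "1 \<le> N" for N
    unfolding D using that by (intro excess_bounds(3)[OF lam greedy less]) simp
  have upper: "D N < I" for N
    using excess_bounds(2)[OF lam greedy less, of N] deficit_pos[OF lam, of N] by (simp add: D I)
  have "bounded (D ` {1..})"
    using nonneg upper by (intro boundedI[of _ I]) (auto intro: less_imp_le)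
  moreover have low: "liminf (\<lambda>N. ereal (D N)) = 0"
  proof (rule antisym)
    have "D (2 ^ n) = deficit lam n - deficit lam (Suc n)" for n
      using excess_add_power(2)[OF lam greedy, where n = n and m = 0] by (simp add: D excess_0)
    moreover have "(\<lambda>n. deficit lam n - deficit lam (Suc n)) \<longlonglongrightarrow> 0 - 0"
      by (intro tendsto_diff LIMSEQ_Suc deficit_tendsto_0 lam)
    ultimately have "(\<lambda>n. ereal (D (2 ^ n))) \<longlonglongrightarrow> ereal 0" by simp
    then have "liminf ((\<lambda>N. ereal (D N)) \<circ> (\<lambda>n. 2 ^ n)) = 0"
      by (simp add: o_def lim_imp_Liminf zero_ereal_def)
    then show "liminf (\<lambda>N. ereal (D N)) \<le> 0"
      using liminf_subseq_mono[of "\<lambda>n. 2 ^ n" "\<lambda>N. ereal (D N)"] by (simp add: strict_mono_def)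
    show "0 \<le> liminf (\<lambda>N. ereal (D N))"
      by (intro Liminf_bounded always_eventually allI) (simp add: nonneg)
  qed
  moreover have high: "limsup (\<lambda>N. ereal (D N)) = ereal I"
  proof (rule antisym)
    have "D (2 ^ Suc n - 1) = I - deficit lam (Suc n)" for n
      unfolding D I by (rule excess_bounds(4)[OF lam greedy]) auto
    moreover have "(\<lambda>n. I - deficit lam (Suc n)) \<longlonglongrightarrow> I - 0"
      by (intro tendsto_diff tendsto_const LIMSEQ_Suc deficit_tendsto_0 lam)
    ultimately have "(\<lambda>n. ereal (D (2 ^ Suc n - 1))) \<longlonglongrightarrow> ereal I" by simp
    then have "limsup ((\<lambda>N. ereal (D N)) \<circ> (\<lambda>n. 2 ^ Suc n - 1)) = ereal I"
      by (simp add: o_def lim_imp_Limsup)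
    moreover have "strict_mono (\<lambda>n. 2 ^ Suc n - 1 :: nat)"
      by (intro strict_monoI diff_less_mono) auto
    ultimately show "ereal I \<le> limsup (\<lambda>N. ereal (D N))"
      using limsup_subseq_mono[of "\<lambda>n. 2 ^ Suc n - 1" "\<lambda>N. ereal (D N)"] by simp
    show "limsup (\<lambda>N. ereal (D N)) \<le> ereal I"
      by (intro Limsup_bounded always_eventually allI) (simp add: upper less_imp_le)
  qed
  moreover have "\<not> convergent D"
  proof
    assume "convergent D"
    then obtain L where "D \<longlonglongrightarrow> L" by (auto simp: convergent_def)
    then have lim: "(\<lambda>N. ereal (D N)) \<longlonglongrightarrow> ereal L" by simp
    have "liminf (\<lambda>N. ereal (D N)) = limsup (\<lambda>N. ereal (D N))"
      using lim_imp_Liminf[OF _ lim] lim_imp_Limsup[OF _ lim] by simp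
    then show False using low high deficit_pos[OF lam, of 0] by (simp add: I)
  qed
  ultimately show ?thesis using pos upper by blast
qed

end
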